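(* Let $Q$ be a real $m\times n$ matrix with $Q^TQ=I_n$, leverage scores $\ell_j=\|e_j^TQ\|_2^2$, $1\le j\le m$, and coherence $\mu=\max_{1\le j\le m}\ell_j$, and let $L=\operatorname{diag}(\ell_1,\dots,\ell_m)$. Let $c$ be an integer with $n\le c\le m$, and let $S$ be the $c\times m$ random matrix produced by uniform sampling with replacement. For $0<\epsilon<1$ set $$\delta\equiv 2n\exp\left(-\frac{3}{2}\,\frac{c\,\epsilon^2}{m\,(3\|Q^TLQ\|_2+\epsilon\mu)}\right).$$ If $\delta<1$, then with probability at least $1-\delta$ we have $\operatorname{rank}(SQ)=n$ and $$\kappa(SQ)\le\sqrt{\frac{1+\epsilon}{1-\epsilon}}.$$
   Context: Here $e_1,\dots,e_m$ are the canonical (column) basis vectors of $\mathbb{R}^m$, $\|\cdot\|_2$ is the Euclidean two-norm (for vectors and matrices), and for a real matrix $Z$ of full column rank, $\kappa(Z)\equiv\|Z\|_2\|Z^\dagger\|_2$ is the two-norm condition number, with $Z^\dagger$ the Moore-Penrose inverse. Uniform sampling with replacement: let $k_1,\dots,k_c$ be independent and uniformly distributed on $\{1,\dots,m\}$, and let $S=\sqrt{m/c}\,\begin{pmatrix}e_{k_1}&\cdots&e_{k_c}\end{pmatrix}^T$, a $c\times m$ matrix. *)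

theory Defs
  imports "HOL-Analysis.Analysis" "HOL-Probability.Probability"
begin

text \<open>The norm instance on \<^typ>\<open>real^'n^'m\<close> is the Frobenius norm, not the two-norm.\<close>

definition matrix_norm2 :: "real^'n^'m \<Rightarrow> real" where
  "matrix_norm2 A = onorm ((*v) A)"

definition is_moore_penrose :: "real^'n^'m \<Rightarrow> real^'m^'n \<Rightarrow> bool" where
  "is_moore_penrose A X \<longleftrightarrow>
     A ** X ** A = A \<and> X ** A ** X = X \<and>
     transpose (A ** X) = A ** X \<and> transpose (X ** A) = X ** A"

definition moore_penrose :: "real^'n^'m \<Rightarrow> real^'m^'n" where
  "moore_penrose A = (THE X. is_moore_penrose A X)"

lemma is_moore_penrose_unique:
  assumes "is_moore_penrose A X" and "is_moore_penrose A Y"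
  shows "X = Y"
proof -
  have AX: "A ** X = A ** Y"
  proof -
    have "A ** X = transpose (A ** X)"
      using assms(1) by (simp add: is_moore_penrose_def)
    also have "\<dots> = transpose ((A ** Y) ** (A ** X))"
      using assms(2) by (simp add: is_moore_penrose_def matrix_mul_assoc)
    also have "\<dots> = transpose (A ** X) ** transpose (A ** Y)"
      by (rule matrix_transpose_mul)
    also have "\<dots> = (A ** X) ** (A ** Y)"
      using assms by (simp only: is_moore_penrose_def)
    also have "\<dots> = A ** Y"
      using assms(1) by (simp add: is_moore_penrose_def matrix_mul_assoc)
    finally show ?thesis .
  qed
  have XA: "X ** A = Y ** A"
  proof -
    have "X ** A = transpose (X ** A)"
      using assms(1) by (simp add: is_moore_penrose_def)
    also have "\<dots> = transpose ((X ** A) ** (Y ** A))"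
      using assms(2) by (metis is_moore_penrose_def matrix_mul_assoc)
    also have "\<dots> = transpose (Y ** A) ** transpose (X ** A)"
      by (rule matrix_transpose_mul)
    also have "\<dots> = (Y ** A) ** (X ** A)"
      using assms by (simp only: is_moore_penrose_def)
    also have "\<dots> = Y ** A"
      using assms(1) by (metis is_moore_penrose_def matrix_mul_assoc)
    finally show ?thesis .
  qed
  have "X = X ** (A ** X)"
    using assms(1) by (simp add: is_moore_penrose_def matrix_mul_assoc)
  also have "\<dots> = Y ** A ** Y"
    by (simp add: AX matrix_mul_assoc XA)
  also have "\<dots> = Y"
    using assms(2) by (simp add: is_moore_penrose_def)
  finally show ?thesis .
qed

lemma moore_penrose_eqI: "is_moore_penrose A X \<Longrightarrow> moore_penrose A = X"
  unfolding moore_penrose_def by (blast intro: is_moore_penrose_unique)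

lemma is_moore_penrose_full_column_rank:
  fixes A :: "real^'n^'m"
  assumes "rank A = CARD('n)"
  shows "is_moore_penrose A (matrix_inv (transpose A ** A) ** transpose A)"
proof -
  define G where "G = transpose A ** A"
  have inj: "inj ((*v) A)"
    using assms by (simp add: full_rank_injective)
  have "x = 0" if "G *v x = 0" for x
  proof -
    have "inner (A *v x) (A *v x) = inner ((A *v x) v* A) x"
      by (rule dot_lmul_matrix[symmetric])
    also have "(A *v x) v* A = transpose A *v (A *v x)"
      by simp
    also have "\<dots> = G *v x"
      by (simp only: G_def matrix_vector_mul_assoc)
    finally have "inner (A *v x) (A *v x) = inner (G *v x) x" .
    then have "A *v x = 0"
      using that by simp
    then show ?thesis
      using inj by (metis injD matrix_vector_mult_0_right)
  qed
  then have inv: "invertible G"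
    by (simp add: invertible_left_inverse matrix_left_invertible_ker)
  have l: "matrix_inv G ** G = mat 1" and r: "G ** matrix_inv G = mat 1"
    using inv someI_ex[of "\<lambda>B. G ** B = mat 1 \<and> B ** G = mat 1"]
    by (simp_all add: invertible_def matrix_inv_def)
  have "transpose G = G"
    by (simp add: G_def matrix_transpose_mul)
  then have s: "transpose (matrix_inv G) = matrix_inv G"
    by (metis l r matrix_mul_assoc matrix_mul_lid matrix_mul_rid matrix_transpose_mul transpose_mat)
  have l': "matrix_inv G ** transpose A ** A = mat 1"
    using l by (simp add: G_def matrix_mul_assoc)
  show ?thesis
    unfolding is_moore_penrose_def G_def[symmetric]
    by (simp add: l' matrix_mul_assoc matrix_transpose_mul s transpose_mat)
       (metis l' matrix_mul_assoc matrix_mul_rid)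
qed

definition condition_number :: "real^'n^'m \<Rightarrow> real" where
  "condition_number Z = matrix_norm2 Z * matrix_norm2 (moore_penrose Z)"

definition leverage_score :: "real^'n^'m \<Rightarrow> 'm \<Rightarrow> real" where
  "leverage_score Q j = (norm (axis j 1 v* Q))\<^sup>2"

definition coherence :: "real^'n^'m \<Rightarrow> real" where
  "coherence Q = Max (range (leverage_score Q))"

definition diag_matrix :: "('m \<Rightarrow> real) \<Rightarrow> real^'m^'m" where
  "diag_matrix d = (\<chi> i j. if i = j then d i else 0)"

text \<open>The index types \<^typ>\<open>'m\<close> and \<^typ>\<open>'c\<close> stand for
  $\{1,\dots,m\}$ and $\{1,\dots,c\}$.\<close>

definition uniform_with_replacement :: "'a measure \<Rightarrow> ('c \<Rightarrow> 'a \<Rightarrow> 'm::finite) \<Rightarrow> bool" where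
  "uniform_with_replacement M k \<longleftrightarrow>
     prob_space.indep_vars M (\<lambda>_. count_space UNIV) k UNIV \<and>
     (\<forall>t. distr M (count_space UNIV) (k t) = uniform_count_measure UNIV)"

text \<open>Row \<open>t\<close> is the scaled transpose of the basis vector with index \<open>k t\<close>.\<close>

definition sampling_matrix :: "('c \<Rightarrow> 'm) \<Rightarrow> real^'m^'c" where
  "sampling_matrix k = sqrt (real CARD('m) / real CARD('c)) *\<^sub>R (\<chi> t. axis (k t) 1)"

end

theory Submission
  imports Defs
begin

text \<open>
  Write \<open>q\<^sub>j\<close> for row \<open>j\<close> of \<open>Q\<close>, so that
  \<open>(SQ)\<^sup>T(SQ)\<close> is \<open>m/c\<close> times the sum of the \<open>c\<close> sampled rank-one
  matrices \<open>q q\<^sup>T\<close>. As in the Ahlswede--Winter proof of the matrix Bernstein inequality, both tails of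
  its spectrum are controlled through the expected trace of an exponential. Since all summands have rank
  one, the Golden--Thompson inequality is only needed in the form
  \<open>tr exp (H + s q q\<^sup>T) \<le> tr exp H + (exp (s |q|\<^sup>2) - 1) / |q|\<^sup>2 * (q\<^sup>T exp H q)\<close>.
  It is the integrated form of a differential inequality in \<open>s\<close>, obtained here from difference
  inequalities for small steps, each of them a double sum over the eigenbases of
  the two operators. No matrix exponential is needed: traces and quadratic forms of exponentials
  are sums over an orthonormal eigenbasis. Averaging over the sample one factor at a time,
  where \<open>Q\<^sup>TQ = I\<close> and \<open>Q\<^sup>TLQ\<close> appear as
  first and second moments, gives the bound.
\<close>

section \<open>Spectral theorem for self-adjoint operators\<close>

definition selfadjoint :: "('a::real_inner \<Rightarrow> 'a) \<Rightarrow> bool" where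
  "selfadjoint f \<longleftrightarrow> linear f \<and> (\<forall>x y. f x \<bullet> y = x \<bullet> f y)"

text \<open>Since \<open>B\<close> consists of unit vectors, the eigenvalue of \<open>u\<close> is
  its Rayleigh quotient \<open>u \<bullet> f u\<close>, and no separate eigenvalue function is
  carried along. Completeness is the expansion of every vector.\<close>

definition eigenbasis :: "('a::euclidean_space \<Rightarrow> 'a) \<Rightarrow> 'a set \<Rightarrow> bool" where
  "eigenbasis f B \<longleftrightarrow> finite B \<and> pairwise orthogonal B \<and> (\<forall>u\<in>B. norm u = 1) \<and>
     (\<forall>x. (\<Sum>u\<in>B. (x \<bullet> u) *\<^sub>R u) = x) \<and> (\<forall>u\<in>B. f u = (u \<bullet> f u) *\<^sub>R u)"

text \<open>A maximiser \<open>v\<close> of \<open>x \<bullet> f x\<close> on the compact unit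
  sphere of \<open>V\<close> is an eigenvector: the first-order condition makes \<open>f v\<close>
  orthogonal to all vectors of \<open>V\<close> that are orthogonal to \<open>v\<close>.\<close>

lemma selfadjoint_eigenvector:
  fixes f :: "'a::euclidean_space \<Rightarrow> 'a"
  assumes f: "selfadjoint f" and V: "subspace V" and inv: "\<And>x. x \<in> V \<Longrightarrow> f x \<in> V"
    and ne: "V \<noteq> {0}"
  obtains v where "v \<in> V" "norm v = 1" "f v = (v \<bullet> f v) *\<^sub>R v"
proof -
  have lin: "linear f" and sa: "\<And>x y. f x \<bullet> y = x \<bullet> f y"
    using f by (auto simp: selfadjoint_def)
  define K where "K = V \<inter> sphere 0 1"
  have "compact K"
    unfolding K_def using closed_subspace[OF V] by (simp add: closed_Int_compact)
  moreover obtain w where w: "w \<in> V" "w \<noteq> 0"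
    using ne subspace_0[OF V] by auto
  then have "(1 / norm w) *\<^sub>R w \<in> K"
    by (simp add: K_def subspace_scale[OF V])
  then have "K \<noteq> {}" by blast
  moreover have "continuous_on K (\<lambda>x. x \<bullet> f x)"
    by (intro continuous_intros linear_continuous_on linear_conv_bounded_linear[THEN iffD1] lin)
  ultimately obtain v where v: "v \<in> K" and sup: "\<And>x. x \<in> K \<Longrightarrow> x \<bullet> f x \<le> v \<bullet> f v"
    using continuous_attains_sup[of K "\<lambda>x. x \<bullet> f x"] by blast
  have vV: "v \<in> V" and nv: "norm v = 1" using v by (auto simp: K_def)
  define l where "l = v \<bullet> f v"
  have vv: "v \<bullet> v = 1" using nv by (simp add: norm_eq_1)
  have bound: "x \<bullet> f x \<le> l * (x \<bullet> x)" if x: "x \<in> V" for x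
  proof (cases "x = 0")
    case False
    have "(1 / norm x) *\<^sub>R x \<in> K"
      using False x by (simp add: K_def subspace_scale[OF V])
    from sup[OF this] have "(x \<bullet> f x) / (norm x)\<^sup>2 \<le> l"
      by (simp add: linear_cmul[OF lin] l_def power2_eq_square)
    then show ?thesis
      using False by (simp add: divide_le_eq power2_norm_eq_inner)
  qed (simp add: linear_0[OF lin])
  have orth: "w \<bullet> f v = 0" if w: "w \<in> V" "w \<bullet> v = 0" for w
  proof -
    define b where "b = w \<bullet> f v"
    define c where "c = l * (w \<bullet> w) - w \<bullet> f w"
    have ineq: "2 * t * b \<le> t\<^sup>2 * c" for t
    proof -
      have "v + t *\<^sub>R w \<in> V"
        using vV w by (simp add: subspace_add[OF V] subspace_scale[OF V])
      from bound[OF this] show ?thesis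
        using sa[of v w] w vv
        by (simp add: linear_add[OF lin] linear_cmul[OF lin] inner_simps b_def c_def l_def[symmetric]
            inner_commute power2_eq_square algebra_simps)
    qed
    have c: "0 \<le> c" using bound[OF w(1)] by (simp add: c_def)
    have "b = 0"
    proof (rule ccontr)
      assume "b \<noteq> 0"
      \<comment> \<open>A step small enough for the linear term of \<open>ineq\<close> to beat the
        quadratic one; \<open>c + 1\<close> keeps the quotient defined when
        \<open>c = 0\<close>.\<close>
      define t where "t = b / (c + 1)"
      have "t * (c + 1) = b" using c by (simp add: t_def)
      then have "2 * t * (t * (c + 1)) \<le> t\<^sup>2 * c" using ineq[of t] by simp
      then have "t\<^sup>2 * (c + 2) \<le> 0" by (simp add: power2_eq_square algebra_simps)
      moreover have "t \<noteq> 0" using \<open>b \<noteq> 0\<close> c by (simp add: t_def)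
      then have "0 < t\<^sup>2 * (c + 2)" using c by simp
      ultimately show False by simp
    qed
    then show ?thesis by (simp add: b_def)
  qed
  \<comment> \<open>The part of \<open>f v\<close> orthogonal to \<open>v\<close>. By
    \<open>orth\<close> it is orthogonal to \<open>f v\<close> too, hence to itself.\<close>
  define w where "w = f v - l *\<^sub>R v"
  have "w \<in> V" using inv[OF vV] vV by (simp add: w_def subspace_diff[OF V] subspace_scale[OF V])
  moreover have wv: "w \<bullet> v = 0" by (simp add: w_def inner_simps vv l_def inner_commute)
  ultimately have "w \<bullet> f v = 0" by (rule orth)
  then have "w \<bullet> w = 0" using wv by (subst (2) w_def) (simp add: inner_simps)
  then have "f v = l *\<^sub>R v" by (simp add: w_def)
  with that vV nv show thesis by (simp add: l_def)
qed

text \<open>Induction on the dimension: split off a unit eigenvector \<open>v\<close> and continue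
  in its orthogonal complement within \<open>V\<close>, which \<open>f\<close> preserves by
  self-adjointness.\<close>

lemma selfadjoint_eigenbasis_subspace:
  fixes f :: "'a::euclidean_space \<Rightarrow> 'a"
  assumes f: "selfadjoint f"
  shows "subspace V \<Longrightarrow> (\<And>x. x \<in> V \<Longrightarrow> f x \<in> V) \<Longrightarrow>
    \<exists>B\<subseteq>V. finite B \<and> pairwise orthogonal B \<and> (\<forall>u\<in>B. norm u = 1) \<and>
      (\<forall>x\<in>V. (\<Sum>u\<in>B. (x \<bullet> u) *\<^sub>R u) = x) \<and> (\<forall>u\<in>B. f u = (u \<bullet> f u) *\<^sub>R u)"
proof (induction "dim V" arbitrary: V rule: less_induct)
  case less
  show ?case
  proof (cases "V = {0}")
    case True
    then show ?thesis by (intro exI[of _ "{}"]) auto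
  next
    case False
    then obtain v where v: "v \<in> V" "norm v = 1" "f v = (v \<bullet> f v) *\<^sub>R v"
      using selfadjoint_eigenvector[OF f less.prems] by blast
    have vv: "v \<bullet> v = 1" using v by (simp add: norm_eq_1)
    define W where "W = V \<inter> {x. orthogonal v x}"
    have W: "subspace W"
      unfolding W_def by (intro subspace_inter less.prems subspace_orthogonal_to_vector)
    have "v \<notin> W" using vv by (auto simp: W_def orthogonal_def)
    then have "W \<subset> V" using v by (auto simp: W_def)
    then have "dim W < dim V"
      using dim_psubset[of W V] W less.prems(1) span_eq_iff by metis
    moreover have "f x \<in> W" if "x \<in> W" for x
    proof -
      have "v \<bullet> f x = f v \<bullet> x" using f by (simp add: selfadjoint_def)
      also have "\<dots> = (v \<bullet> f v) * (v \<bullet> x)" by (subst v(3)) simp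
      finally show ?thesis using that less.prems(2) by (auto simp: W_def orthogonal_def)
    qed
    ultimately obtain B where B: "B \<subseteq> W" "finite B" "pairwise orthogonal B" "\<forall>u\<in>B. norm u = 1"
      "\<forall>x\<in>W. (\<Sum>u\<in>B. (x \<bullet> u) *\<^sub>R u) = x" "\<forall>u\<in>B. f u = (u \<bullet> f u) *\<^sub>R u"
      using less.hyps[of W] W by blast
    have Bv: "orthogonal v u" if "u \<in> B" for u using B(1) that by (auto simp: W_def)
    have vB: "v \<notin> B" using B(1) \<open>v \<notin> W\<close> by blast
    have "(\<Sum>u\<in>insert v B. (x \<bullet> u) *\<^sub>R u) = x" if x: "x \<in> V" for x
    proof -
      define y where "y = x - (x \<bullet> v) *\<^sub>R v"
      have "y \<in> W"
        using x v less.prems(1) vv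
        by (auto simp: y_def W_def orthogonal_def inner_simps inner_commute subspace_diff subspace_scale)
      then have "(\<Sum>u\<in>B. (y \<bullet> u) *\<^sub>R u) = y" using B by blast
      moreover have "y \<bullet> u = x \<bullet> u" if "u \<in> B" for u
        using Bv[OF that] by (simp add: y_def inner_simps orthogonal_def)
      ultimately have "(\<Sum>u\<in>B. (x \<bullet> u) *\<^sub>R u) = y" by simp
      then show ?thesis using B(2) vB by (simp add: y_def)
    qed
    moreover have "pairwise orthogonal (insert v B)"
      using B(3) Bv by (auto simp: pairwise_insert orthogonal_commute)
    ultimately show ?thesis
      using v B \<open>W \<subset> V\<close> by (intro exI[of _ "insert v B"]) auto
  qed
qed

theorem selfadjoint_eigenbasis_exists:
  assumes "selfadjoint f"
  obtains B where "eigenbasis f B"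
  using selfadjoint_eigenbasis_subspace[OF assms, of UNIV] by (auto simp: eigenbasis_def)

lemma eigenbasis_parseval:
  assumes "eigenbasis f B"
  shows "(\<Sum>u\<in>B. (x \<bullet> u) * (u \<bullet> y)) = x \<bullet> y"
proof -
  have "x \<bullet> y = (\<Sum>u\<in>B. (x \<bullet> u) *\<^sub>R u) \<bullet> y"
    using assms by (simp add: eigenbasis_def)
  then show ?thesis by (simp add: inner_sum_left)
qed

lemma eigenbasis_norm:
  assumes "eigenbasis f B"
  shows "(\<Sum>u\<in>B. (x \<bullet> u)\<^sup>2) = (norm x)\<^sup>2"
  using eigenbasis_parseval[OF assms, of x x]
  by (simp add: power2_eq_square inner_commute power2_norm_eq_inner[unfolded power2_eq_square])

lemma eigenbasis_card:
  fixes f :: "'a::euclidean_space \<Rightarrow> 'a"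
  assumes "eigenbasis f B"
  shows "card B \<le> DIM('a)"
proof -
  have "0 \<notin> B" using assms by (force simp: eigenbasis_def)
  then have "independent B"
    using assms pairwise_orthogonal_independent by (auto simp: eigenbasis_def)
  then show ?thesis using independent_bound by blast
qed

text \<open>This is the matrix element of \<open>A - B\<close> between the two eigenbases. It trades
  a difference of eigenvalues for the perturbation, so that double sums over both bases reduce to
  scalar inequalities for pairs of eigenvalues.\<close>

lemma eigenbasis_cross:
  assumes A: "selfadjoint A" "eigenbasis A U" and B: "eigenbasis B V"
    and "u \<in> U" "v \<in> V"
  shows "(u \<bullet> A u - v \<bullet> B v) * (u \<bullet> v) = u \<bullet> (A v - B v)"
proof -
  have "(u \<bullet> A u) * (u \<bullet> v) = A u \<bullet> v"
    using A(2) \<open>u \<in> U\<close> by (metis eigenbasis_def inner_scaleR_left)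
  also have "\<dots> = u \<bullet> A v" using A(1) by (simp add: selfadjoint_def)
  finally have "(u \<bullet> A u) * (u \<bullet> v) = u \<bullet> A v" .
  moreover have "(v \<bullet> B v) * (u \<bullet> v) = u \<bullet> B v"
    using B \<open>v \<in> V\<close> by (metis eigenbasis_def inner_scaleR_right)
  ultimately show ?thesis by (simp add: inner_diff_right left_diff_distrib)
qed

section \<open>Traces of exponentials under rank-one perturbations\<close>

text \<open>For an orthonormal eigenbasis of \<open>f\<close> these are \<open>tr e\<^sup>f\<close> and \<open>q\<^sup>T e\<^sup>f q\<close>.\<close>

definition trace_exp_basis :: "('a::euclidean_space \<Rightarrow> 'a) \<Rightarrow> 'a set \<Rightarrow> real" where
  "trace_exp_basis f B = (\<Sum>u\<in>B. exp (u \<bullet> f u))"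

definition quad_exp_basis :: "('a::euclidean_space \<Rightarrow> 'a) \<Rightarrow> 'a set \<Rightarrow> 'a \<Rightarrow> real" where
  "quad_exp_basis f B q = (\<Sum>u\<in>B. exp (u \<bullet> f u) * (q \<bullet> u)\<^sup>2)"

text \<open>The logarithmic mean of \<open>exp a\<close> and \<open>exp b\<close> is at most their
  arithmetic mean. The factor \<open>(a - b)\<^sup>2\<close> makes the form symmetric and covers
  \<open>a = b\<close>.\<close>

lemma exp_diff_mult_le:
  fixes a b :: real
  shows "(a - b) * (exp a - exp b) \<le> (a - b)\<^sup>2 * ((exp a + exp b) / 2)"
proof -
  have *: "(a - b) * (exp a - exp b) \<le> (a - b)\<^sup>2 * ((exp a + exp b) / 2)" if "b \<le> a" for a b :: real
  proof -
    \<comment> \<open>The case \<open>b = 0\<close>; multiplying by \<open>exp b\<close> restores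
      the general one. The derivative is half of \<open>1 - (1 - x) * exp x\<close>.\<close>
    define h where "h = (\<lambda>x::real. x * (exp x + 1) / 2 - (exp x - 1))"
    have "h 0 \<le> h (a - b)"
    proof (rule DERIV_nonneg_imp_nondecreasing[where f = h])
      fix x :: real assume "0 \<le> x" "x \<le> a - b"
      have "(h has_real_derivative ((exp x + 1) / 2 + x * exp x / 2 - exp x)) (at x)"
        unfolding h_def by (auto intro!: derivative_eq_intros simp: field_simps)
      moreover have "(1 + -x) * exp x \<le> exp (-x) * exp x"
        by (intro mult_right_mono exp_ge_add_one_self) auto
      then have "0 \<le> (exp x + 1) / 2 + x * exp x / 2 - exp x"
        by (simp add: exp_minus field_simps)
      ultimately show "\<exists>y. (h has_real_derivative y) (at x) \<and> 0 \<le> y" by blast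
    qed (use that in auto)
    then have "exp (a - b) - 1 \<le> (a - b) * ((exp (a - b) + 1) / 2)" by (simp add: h_def)
    then have "(exp (a - b) - 1) * exp b \<le> (a - b) * ((exp (a - b) + 1) / 2) * exp b"
      by (intro mult_right_mono) auto
    moreover have e: "exp (a - b) * exp b = exp a" by (simp flip: exp_add)
    ultimately have "exp a - exp b \<le> (a - b) * ((exp a + exp b) / 2)"
      using e by (simp add: algebra_simps add_divide_distrib)
    then have "(a - b) * (exp a - exp b) \<le> (a - b) * ((a - b) * ((exp a + exp b) / 2))"
      using that by (intro mult_left_mono) auto
    then show ?thesis by (simp add: power2_eq_square)
  qed
  show ?thesis
  proof (cases "b \<le> a")
    case False
    then show ?thesis using *[of a b] by (simp add: power2_commute algebra_simps)
  qed (rule *)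
qed

text \<open>Klein's inequality: convexity gives \<open>exp a - exp b \<le> exp a * (a - b)\<close>
  for each pair of eigenvalues, and the squared overlaps \<open>(u \<bullet> v)\<^sup>2\<close> are
  doubly stochastic weights. The tangent is taken at \<open>A\<close>, hence the quadratic form of
  \<open>A\<close> on the right.\<close>

lemma trace_exp_basis_step:
  fixes q :: "'a::euclidean_space"
  assumes A: "selfadjoint A" "eigenbasis A U" and B: "eigenbasis B V"
    and AB: "\<And>x. A x = B x + (h * (q \<bullet> x)) *\<^sub>R q"
  shows "trace_exp_basis A U - trace_exp_basis B V \<le> h * quad_exp_basis A U q"
proof -
  have U1: "norm u = 1" if "u \<in> U" for u using A that by (auto simp: eigenbasis_def)
  have V1: "norm v = 1" if "v \<in> V" for v using B that by (auto simp: eigenbasis_def)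
  have "trace_exp_basis A U = (\<Sum>u\<in>U. \<Sum>v\<in>V. exp (u \<bullet> A u) * (u \<bullet> v)\<^sup>2)"
    by (simp add: trace_exp_basis_def eigenbasis_norm[OF B] U1 flip: sum_distrib_left)
  moreover have "trace_exp_basis B V = (\<Sum>u\<in>U. \<Sum>v\<in>V. exp (v \<bullet> B v) * (u \<bullet> v)\<^sup>2)"
    by (subst sum.swap)
       (simp add: trace_exp_basis_def inner_commute[of _ "_::'a"] eigenbasis_norm[OF A(2)] V1 flip: sum_distrib_left)
  ultimately have "trace_exp_basis A U - trace_exp_basis B V =
      (\<Sum>u\<in>U. \<Sum>v\<in>V. (exp (u \<bullet> A u) - exp (v \<bullet> B v)) * (u \<bullet> v)\<^sup>2)"
    by (simp add: left_diff_distrib sum_subtractf)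
  also have "\<dots> \<le> (\<Sum>u\<in>U. \<Sum>v\<in>V. exp (u \<bullet> A u) * (u \<bullet> v) * (h * (q \<bullet> v) * (u \<bullet> q)))"
  proof (intro sum_mono)
    fix u v assume uv: "u \<in> U" "v \<in> V"
    define a b where "a = u \<bullet> A u" and "b = v \<bullet> B v"
    have "exp a * (1 + (b - a)) \<le> exp a * exp (b - a)"
      by (intro mult_left_mono exp_ge_add_one_self) auto
    then have "exp a - exp b \<le> exp a * (a - b)" by (simp add: algebra_simps flip: exp_add)
    then have "(exp a - exp b) * (u \<bullet> v)\<^sup>2 \<le> exp a * (a - b) * (u \<bullet> v)\<^sup>2"
      by (intro mult_right_mono) auto
    also have "\<dots> = exp a * (u \<bullet> v) * ((a - b) * (u \<bullet> v))" by (simp add: power2_eq_square)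
    also have "(a - b) * (u \<bullet> v) = h * (q \<bullet> v) * (u \<bullet> q)"
      using eigenbasis_cross[OF A B uv] by (simp add: a_def b_def AB)
    finally show "(exp (u \<bullet> A u) - exp (v \<bullet> B v)) * (u \<bullet> v)\<^sup>2
        \<le> exp (u \<bullet> A u) * (u \<bullet> v) * (h * (q \<bullet> v) * (u \<bullet> q))"
      by (simp add: a_def b_def)
  qed
  also have "\<dots> = (\<Sum>u\<in>U. h * exp (u \<bullet> A u) * (u \<bullet> q) * (\<Sum>v\<in>V. (u \<bullet> v) * (v \<bullet> q)))"
    by (simp add: sum_distrib_left inner_commute mult_ac)
  also have "\<dots> = h * quad_exp_basis A U q"
    unfolding eigenbasis_parseval[OF B] quad_exp_basis_def
    by (simp add: sum_distrib_left inner_commute power2_eq_square mult_ac)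
  finally show ?thesis .
qed

text \<open>The discrete form of \<open>g' \<le> |q|\<^sup>2 g\<close> for \<open>g(s) = q\<^sup>T exp (H + s q q\<^sup>T) q\<close>, valid for both signs of the step \<open>h\<close>.\<close>

lemma quad_exp_basis_step:
  fixes q :: "'a::euclidean_space"
  assumes A: "selfadjoint A" "eigenbasis A U" and B: "eigenbasis B V"
    and AB: "\<And>x. A x = B x + (h * (q \<bullet> x)) *\<^sub>R q"
  shows "h * (quad_exp_basis A U q - quad_exp_basis B V q)
    \<le> h\<^sup>2 * (norm q)\<^sup>2 * ((quad_exp_basis A U q + quad_exp_basis B V q) / 2)"
proof -
  \<comment> \<open>One factor \<open>q \<bullet> u\<close> is expanded in the other basis, which
    turns both quadratic forms into sums over the same pairs with the same weights.\<close>
  have "quad_exp_basis A U q = (\<Sum>u\<in>U. exp (u \<bullet> A u) * (q \<bullet> u) * (\<Sum>v\<in>V. (q \<bullet> v) * (v \<bullet> u)))"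
    unfolding eigenbasis_parseval[OF B] by (simp add: quad_exp_basis_def power2_eq_square mult_ac)
  also have "\<dots> = (\<Sum>u\<in>U. \<Sum>v\<in>V. exp (u \<bullet> A u) * (q \<bullet> u) * (q \<bullet> v) * (u \<bullet> v))"
    by (simp add: sum_distrib_left inner_commute mult_ac)
  finally have gA: "quad_exp_basis A U q = \<dots>" .
  have "quad_exp_basis B V q = (\<Sum>v\<in>V. exp (v \<bullet> B v) * (q \<bullet> v) * (\<Sum>u\<in>U. (q \<bullet> u) * (u \<bullet> v)))"
    unfolding eigenbasis_parseval[OF A(2)] by (simp add: quad_exp_basis_def power2_eq_square mult_ac)
  also have "\<dots> = (\<Sum>u\<in>U. \<Sum>v\<in>V. exp (v \<bullet> B v) * (q \<bullet> u) * (q \<bullet> v) * (u \<bullet> v))"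
    by (subst sum.swap) (simp add: sum_distrib_left mult_ac)
  finally have gB: "quad_exp_basis B V q = \<dots>" .
  have "h * (quad_exp_basis A U q - quad_exp_basis B V q) =
      (\<Sum>u\<in>U. \<Sum>v\<in>V. (exp (u \<bullet> A u) - exp (v \<bullet> B v)) * (u \<bullet> v) * (h * (q \<bullet> v) * (u \<bullet> q)))"
    unfolding gA gB
    by (simp add: sum_distrib_left flip: sum_subtractf) (simp add: algebra_simps inner_commute)
  \<comment> \<open>The weights may be negative. By \<open>eigenbasis_cross\<close> the last factor
    is \<open>(a - b) * (u \<bullet> v)\<close>, which completes the square
    \<open>(u \<bullet> v)\<^sup>2\<close> and allows a termwise comparison.\<close>
  also have "\<dots> \<le> (\<Sum>u\<in>U. \<Sum>v\<in>V. (h * (q \<bullet> v) * (u \<bullet> q))\<^sup>2 * ((exp (u \<bullet> A u) + exp (v \<bullet> B v)) / 2))"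
  proof (intro sum_mono)
    fix u v assume uv: "u \<in> U" "v \<in> V"
    define a b where "a = u \<bullet> A u" and "b = v \<bullet> B v"
    have e: "h * (q \<bullet> v) * (u \<bullet> q) = (a - b) * (u \<bullet> v)"
      using eigenbasis_cross[OF A B uv] by (simp add: a_def b_def AB)
    have "(a - b) * (exp a - exp b) * (u \<bullet> v)\<^sup>2 \<le> (a - b)\<^sup>2 * ((exp a + exp b) / 2) * (u \<bullet> v)\<^sup>2"
      by (intro mult_right_mono exp_diff_mult_le) auto
    then have "(exp a - exp b) * (u \<bullet> v) * ((a - b) * (u \<bullet> v))
        \<le> ((a - b) * (u \<bullet> v))\<^sup>2 * ((exp a + exp b) / 2)"
      by (simp add: power2_eq_square mult_ac)
    then show "(exp (u \<bullet> A u) - exp (v \<bullet> B v)) * (u \<bullet> v) * (h * (q \<bullet> v) * (u \<bullet> q))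
        \<le> (h * (q \<bullet> v) * (u \<bullet> q))\<^sup>2 * ((exp (u \<bullet> A u) + exp (v \<bullet> B v)) / 2)"
      unfolding e by (simp add: a_def b_def)
  qed
  also have "\<dots> = h\<^sup>2 / 2 * ((\<Sum>u\<in>U. \<Sum>v\<in>V. exp (u \<bullet> A u) * (q \<bullet> u)\<^sup>2 * (q \<bullet> v)\<^sup>2)
      + (\<Sum>u\<in>U. \<Sum>v\<in>V. exp (v \<bullet> B v) * (q \<bullet> v)\<^sup>2 * (q \<bullet> u)\<^sup>2))"
    by (simp add: sum_distrib_left flip: sum.distrib)
       (simp add: field_simps power_mult_distrib inner_commute)
  also have "(\<Sum>u\<in>U. \<Sum>v\<in>V. exp (u \<bullet> A u) * (q \<bullet> u)\<^sup>2 * (q \<bullet> v)\<^sup>2) = (norm q)\<^sup>2 * quad_exp_basis A U q"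
    by (simp add: eigenbasis_norm[OF B] quad_exp_basis_def sum_distrib_left mult_ac flip: sum_distrib_left[of _ _ V])
  also have "(\<Sum>u\<in>U. \<Sum>v\<in>V. exp (v \<bullet> B v) * (q \<bullet> v)\<^sup>2 * (q \<bullet> u)\<^sup>2) = (norm q)\<^sup>2 * quad_exp_basis B V q"
    by (subst sum.swap)
       (simp add: eigenbasis_norm[OF A(2)] quad_exp_basis_def sum_distrib_left mult_ac flip: sum_distrib_left[of _ _ U])
  finally show ?thesis by (simp add: algebra_simps)
qed

lemma selfadjoint_add_rank_one:
  assumes "selfadjoint H"
  shows "selfadjoint (\<lambda>x. H x + (s * (q \<bullet> x)) *\<^sub>R q)"
  using assms unfolding selfadjoint_def
  by (auto intro!: linear_compose_add linearI
      simp: inner_simps inner_commute linear_add linear_cmul algebra_simps)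

text \<open>Over \<open>k\<close> steps of size \<open>h\<close> the values \<open>h * g k\<close>
  stay below a geometric sequence whose ratio \<open>r\<close> is a rational approximation of
  \<open>exp \<eta>\<close>. The trace increments then add up to a geometric series.\<close>

lemma trace_exp_basis_iterate:
  fixes q :: "'a::euclidean_space" and h :: real
  defines "\<eta> \<equiv> h * (norm q)\<^sup>2"
  defines "r \<equiv> (1 + \<eta> / 2) / (1 - \<eta> / 2)"
  assumes H: "selfadjoint H" and U: "\<And>k. eigenbasis (\<lambda>x. H x + (real k * h * (q \<bullet> x)) *\<^sub>R q) (U k)"
    and q: "q \<noteq> 0" and \<eta>: "\<bar>\<eta>\<bar> < 2"
  defines "f \<equiv> \<lambda>k. trace_exp_basis (\<lambda>x. H x + (real k * h * (q \<bullet> x)) *\<^sub>R q) (U k)"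
  defines "g \<equiv> \<lambda>k. quad_exp_basis (\<lambda>x. H x + (real k * h * (q \<bullet> x)) *\<^sub>R q) (U k) q"
  shows "f k \<le> f 0 + (1 + \<eta> / 2) * (r ^ k - 1) / (norm q)\<^sup>2 * g 0"
proof -
  have sa: "selfadjoint (\<lambda>x. H x + (real k * h * (q \<bullet> x)) *\<^sub>R q)" for k
    by (rule selfadjoint_add_rank_one[OF H])
  have pos: "0 < 1 - \<eta> / 2" "0 < 1 + \<eta> / 2" using \<eta> by auto
  then have r: "0 < r" by (simp add: r_def)
  have step: "H x + (real (Suc k) * h * (q \<bullet> x)) *\<^sub>R q
      = (H x + (real k * h * (q \<bullet> x)) *\<^sub>R q) + (h * (q \<bullet> x)) *\<^sub>R q" for k x
    by (simp add: algebra_simps flip: scaleR_add_left)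
  have f: "f (Suc k) \<le> f k + h * g (Suc k)" for k
    using trace_exp_basis_step[OF sa U U step, of k] by (simp add: f_def g_def)
  \<comment> \<open>The factor \<open>h\<close> is kept because its sign is free. Since
    \<open>1 - \<eta> / 2\<close> is positive, the averaged bound can be solved for the new
    value.\<close>
  have g: "h * g (Suc k) \<le> r * (h * g k)" for k
  proof -
    have "h * (g (Suc k) - g k) \<le> h\<^sup>2 * (norm q)\<^sup>2 * ((g (Suc k) + g k) / 2)"
      using quad_exp_basis_step[OF sa U U step, of k] by (simp add: g_def)
    then have "h * g (Suc k) * (1 - \<eta> / 2) \<le> h * g k * (1 + \<eta> / 2)"
      by (simp add: \<eta>_def field_simps power2_eq_square)
    then show ?thesis using pos by (simp add: r_def field_simps)
  qed
  have G: "h * g k \<le> h * r ^ k * g 0" for k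
  proof (induction k)
    case (Suc k)
    have "h * g (Suc k) \<le> r * (h * r ^ k * g 0)"
      using g[of k] mult_left_mono[OF Suc, of r] r by linarith
    then show ?case by (simp add: mult_ac)
  qed simp
  show "f k \<le> f 0 + (1 + \<eta> / 2) * (r ^ k - 1) / (norm q)\<^sup>2 * g 0"
  proof (induction k)
    case (Suc k)
    \<comment> \<open>This makes the series telescope:
      \<open>(1 + \<eta> / 2) / (norm q)\<^sup>2\<close> stands for \<open>h * r / (r - 1)\<close>
      and keeps its meaning at \<open>h = 0\<close>.\<close>
    have "(1 + \<eta> / 2) * (r - 1) = r * \<eta>"
      using pos by (simp add: r_def field_simps)
    then have "r ^ k * ((1 + \<eta> / 2) * (r - 1)) = h * r ^ Suc k * (norm q)\<^sup>2"
      by (simp add: \<eta>_def)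
    then have "h * r ^ Suc k = r ^ k * ((1 + \<eta> / 2) * (r - 1)) / (norm q)\<^sup>2"
      using q by (simp add: field_simps)
    also have "\<dots> = (1 + \<eta> / 2) * (r ^ Suc k - 1) / (norm q)\<^sup>2
        - (1 + \<eta> / 2) * (r ^ k - 1) / (norm q)\<^sup>2"
      by (simp add: algebra_simps diff_divide_distrib add_divide_distrib)
    finally have "h * r ^ Suc k * g 0 = (1 + \<eta> / 2) * (r ^ Suc k - 1) / (norm q)\<^sup>2 * g 0
        - (1 + \<eta> / 2) * (r ^ k - 1) / (norm q)\<^sup>2 * g 0"
      by (simp only: left_diff_distrib)
    then show ?case using Suc f[of k] G[of "Suc k"] by linarith
  qed simp
qed

text \<open>For \<open>q = 0\<close> the quotient is \<open>0 / 0 = 0\<close>.\<close>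

theorem trace_exp_basis_add_rank_one_le:
  fixes q :: "'a::euclidean_space" and s :: real
  assumes H: "selfadjoint H" and U: "eigenbasis H U"
    and V: "eigenbasis (\<lambda>x. H x + (s * (q \<bullet> x)) *\<^sub>R q) V"
  shows "trace_exp_basis (\<lambda>x. H x + (s * (q \<bullet> x)) *\<^sub>R q) V
    \<le> trace_exp_basis H U + (exp (s * (norm q)\<^sup>2) - 1) / (norm q)\<^sup>2 * quad_exp_basis H U q"
proof (cases "q = 0")
  case True
  then show ?thesis
    using trace_exp_basis_step[OF selfadjoint_add_rank_one[OF H] V U refl] by (simp add: quad_exp_basis_def)
next
  case False
  define x where "x = s * (norm q)\<^sup>2"
  define r where "r = (\<lambda>N. (1 + (x / 2) / real N) / (1 + (- x / 2) / real N))"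
  have bound: "trace_exp_basis (\<lambda>x. H x + (s * (q \<bullet> x)) *\<^sub>R q) V
    \<le> trace_exp_basis H U + (1 + x / real N / 2) * (r N ^ N - 1) / (norm q)\<^sup>2 * quad_exp_basis H U q"
    if N: "0 < N" "\<bar>x\<bar> < 2 * real N" for N
  proof -
    define h where "h = s / real N"
    have hN: "real N * h = s" using N by (simp add: h_def)
    have \<eta>: "h * (norm q)\<^sup>2 = x / real N" by (simp add: h_def x_def)
    have "\<exists>B. eigenbasis (\<lambda>x. H x + (real k * h * (q \<bullet> x)) *\<^sub>R q) B" for k
      using selfadjoint_eigenbasis_exists[OF selfadjoint_add_rank_one[OF H]] by blast
    then obtain W where W: "\<And>k. eigenbasis (\<lambda>x. H x + (real k * h * (q \<bullet> x)) *\<^sub>R q) (W k)"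
      by metis
    \<comment> \<open>The given eigenbases are put at the two ends of the path from \<open>H\<close>
      to the perturbed operator; those in between are arbitrary.\<close>
    define W' where "W' = W(0 := U, N := V)"
    have W': "eigenbasis (\<lambda>x. H x + (real k * h * (q \<bullet> x)) *\<^sub>R q) (W' k)" for k
      using W U V N by (simp add: W'_def hN)
    have "\<bar>h * (norm q)\<^sup>2\<bar> < 2" unfolding \<eta> using N by (simp add: field_simps)
    from trace_exp_basis_iterate[OF H W' False this, of N] show ?thesis
      using N unfolding \<eta> hN by (simp add: W'_def r_def algebra_simps)
  qed
  \<comment> \<open>As the step size \<open>s / N\<close> tends to zero, the accumulated ratio tends
    to \<open>exp x\<close>.\<close>
  have "(\<lambda>N. (1 + (x / 2) / real N) ^ N / (1 + (- x / 2) / real N) ^ N)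
      \<longlonglongrightarrow> exp (x / 2) / exp (- x / 2)"
    by (intro tendsto_divide tendsto_exp_limit_sequentially) auto
  also have "exp (x / 2) / exp (- x / 2) = exp x" by (simp flip: exp_diff)
  finally have "(\<lambda>N. r N ^ N) \<longlonglongrightarrow> exp x" by (simp add: r_def power_divide)
  moreover have "(\<lambda>N. x / real N) \<longlonglongrightarrow> 0" by (rule lim_const_over_n)
  ultimately have "(\<lambda>N. trace_exp_basis H U + (1 + x / real N / 2) * (r N ^ N - 1) / (norm q)\<^sup>2 * quad_exp_basis H U q)
      \<longlonglongrightarrow> trace_exp_basis H U + (1 + 0 / 2) * (exp x - 1) / (norm q)\<^sup>2 * quad_exp_basis H U q"
    using False by (intro tendsto_intros) auto
  moreover have "\<forall>\<^sub>F N in sequentially. \<bar>x\<bar> < 2 * real N"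
    by real_asymp
  then have "\<forall>\<^sub>F N in sequentially. trace_exp_basis (\<lambda>x. H x + (s * (q \<bullet> x)) *\<^sub>R q) V
      \<le> trace_exp_basis H U + (1 + x / real N / 2) * (r N ^ N - 1) / (norm q)\<^sup>2 * quad_exp_basis H U q"
    using eventually_gt_at_top[of 0] by eventually_elim (rule bound)
  ultimately show ?thesis
    using tendsto_lowerbound by (force simp: x_def)
qed

section \<open>The scalar Bernstein inequality\<close>

text \<open>The sharpest admissible value of \<open>b\<close> is \<open>max 0 y\<close>; the bound
  is proved for it and is monotone in \<open>b\<close>.\<close>

lemma exp_le_quadratic:
  fixes y b :: real
  assumes "y \<le> b" "0 \<le> b" "b < 3"
  shows "exp y \<le> 1 + y + y\<^sup>2 / (2 * (1 - b / 3))"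
proof -
  have "exp y \<le> 1 + y + y\<^sup>2 / (2 * (1 - max 0 y / 3))"
  proof (cases "0 \<le> y")
    case True
    \<comment> \<open>\<open>0 \<le> F y\<close> is the claim multiplied by \<open>1 - y / 3\<close>
      and by \<open>exp (- y)\<close>. Its derivative is governed by the quadratic Taylor bound for
      \<open>exp\<close>.\<close>
    define F where "F = (\<lambda>y::real. (1 + 2 * y / 3 + y\<^sup>2 / 6) * exp (- y) - (1 - y / 3))"
    have "F 0 \<le> F y"
    proof (rule DERIV_nonneg_imp_nondecreasing[where f = F])
      fix x :: real assume x: "0 \<le> x" "x \<le> y"
      have "(F has_real_derivative (1 - (1 + x + x\<^sup>2 / 2) * exp (- x)) / 3) (at x)"
        unfolding F_def by (auto intro!: derivative_eq_intros simp: field_simps power2_eq_square)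
      moreover have "(1 + x + x\<^sup>2 / 2) * exp (- x) \<le> exp x * exp (- x)"
        using exp_lower_Taylor_quadratic[OF x(1)] by (intro mult_right_mono) auto
      then have "0 \<le> (1 - (1 + x + x\<^sup>2 / 2) * exp (- x)) / 3" by (simp flip: exp_add)
      ultimately show "\<exists>z. (F has_real_derivative z) (at x) \<and> 0 \<le> z" by blast
    qed (use True in auto)
    then have "(1 - y / 3) * exp y \<le> (1 + 2 * y / 3 + y\<^sup>2 / 6) * exp (- y) * exp y"
      by (intro mult_right_mono) (auto simp: F_def)
    also have "\<dots> = 1 + 2 * y / 3 + y\<^sup>2 / 6" by (simp add: mult.assoc flip: exp_add)
    finally show ?thesis using True assms by (simp add: field_simps power2_eq_square)
  next
    case False
    define F where "F = (\<lambda>y::real. exp y - 1 - y - y\<^sup>2 / 2)"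
    have "F y \<le> F 0"
    proof (rule DERIV_nonneg_imp_nondecreasing[where f = F])
      fix x :: real
      have "(F has_real_derivative (exp x - 1 - x)) (at x)"
        unfolding F_def by (auto intro!: derivative_eq_intros)
      moreover have "0 \<le> exp x - 1 - x" using exp_ge_add_one_self[of x] by linarith
      ultimately show "\<exists>z. (F has_real_derivative z) (at x) \<and> 0 \<le> z" by blast
    qed (use False in auto)
    then show ?thesis using False by (simp add: F_def)
  qed
  also have "\<dots> \<le> 1 + y + y\<^sup>2 / (2 * (1 - b / 3))"
    using assms by (intro add_left_mono divide_left_mono) auto
  finally show ?thesis .
qed

section \<open>Averaging trace exponentials over uniform samples\<close>

text \<open>The perturbation inequality holds for every pair of eigenbases, so it applies to the
  ones fixed here by choice.\<close>

definition trace_exp :: "('a::euclidean_space \<Rightarrow> 'a) \<Rightarrow> real" where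
  "trace_exp f = trace_exp_basis f (SOME B. eigenbasis f B)"

text \<open>The Rayleigh quotient of \<open>x\<close> is a weighted average of eigenvalues, so some
  eigenvalue is at least \<open>a\<close>; its exponential is one of the positive terms of the
  trace.\<close>

lemma exp_le_trace_exp:
  assumes f: "selfadjoint f" and "x \<noteq> 0" "a * (norm x)\<^sup>2 \<le> x \<bullet> f x"
  shows "exp a \<le> trace_exp f"
proof -
  define B where "B = (SOME B. eigenbasis f B)"
  have B: "eigenbasis f B"
    using selfadjoint_eigenbasis_exists[OF f] unfolding B_def by (metis someI)
  have fin: "finite B" and ev: "\<And>u. u \<in> B \<Longrightarrow> f u = (u \<bullet> f u) *\<^sub>R u"
    using B by (auto simp: eigenbasis_def)
  have "x \<bullet> f x = (\<Sum>u\<in>B. (u \<bullet> f u) * (x \<bullet> u)\<^sup>2)"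
  proof -
    have "x \<bullet> f x = (\<Sum>u\<in>B. (x \<bullet> u) * (u \<bullet> f x))"
      by (rule eigenbasis_parseval[OF B, symmetric])
    also have "\<dots> = (\<Sum>u\<in>B. (u \<bullet> f u) * (x \<bullet> u)\<^sup>2)"
    proof (intro sum.cong refl)
      fix u assume "u \<in> B"
      have "u \<bullet> f x = f u \<bullet> x" using f by (simp add: selfadjoint_def)
      also have "\<dots> = (u \<bullet> f u) * (u \<bullet> x)" by (subst ev[OF \<open>u \<in> B\<close>]) simp
      finally show "(x \<bullet> u) * (u \<bullet> f x) = (u \<bullet> f u) * (x \<bullet> u)\<^sup>2"
        by (simp add: power2_eq_square inner_commute)
    qed
    finally show ?thesis .
  qed
  with assms(3) have le: "(\<Sum>u\<in>B. a * (x \<bullet> u)\<^sup>2) \<le> (\<Sum>u\<in>B. (u \<bullet> f u) * (x \<bullet> u)\<^sup>2)"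
    using eigenbasis_norm[OF B] by (simp flip: sum_distrib_left)
  have "\<exists>u\<in>B. a \<le> u \<bullet> f u"
  proof (rule ccontr)
    assume "\<not> ?thesis"
    then have less: "u \<bullet> f u < a" if "u \<in> B" for u using that by (meson not_le)
    have "0 < (\<Sum>u\<in>B. (x \<bullet> u)\<^sup>2)" using eigenbasis_norm[OF B] \<open>x \<noteq> 0\<close> by simp
    then obtain w where w: "w \<in> B" "0 < (x \<bullet> w)\<^sup>2"
      by (metis not_less sum_nonpos)
    have "(\<Sum>u\<in>B. (u \<bullet> f u) * (x \<bullet> u)\<^sup>2) < (\<Sum>u\<in>B. a * (x \<bullet> u)\<^sup>2)"
    proof (rule sum_strict_mono_ex1[OF fin])
      show "\<forall>u\<in>B. (u \<bullet> f u) * (x \<bullet> u)\<^sup>2 \<le> a * (x \<bullet> u)\<^sup>2"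
        by (intro ballI mult_right_mono less_imp_le[OF less]) auto
      show "\<exists>u\<in>B. (u \<bullet> f u) * (x \<bullet> u)\<^sup>2 < a * (x \<bullet> u)\<^sup>2"
        using w less by (intro bexI[of _ w] mult_strict_right_mono) auto
    qed
    with le show False by simp
  qed
  then obtain u where u: "u \<in> B" "a \<le> u \<bullet> f u" by blast
  have "exp a \<le> exp (u \<bullet> f u)" using u by simp
  also have "\<dots> \<le> trace_exp_basis f B"
    unfolding trace_exp_basis_def using u fin by (intro member_le_sum) auto
  finally show ?thesis by (simp add: trace_exp_def B_def)
qed

lemma trace_exp_nonneg: "0 \<le> trace_exp f"
  by (simp add: trace_exp_def trace_exp_basis_def sum_nonneg)

text \<open>One uniform draw, summed over its outcomes. The linear part of the scalar bound meets
  the first moment, which \<open>frame\<close> makes the identity; the quadratic part meets the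
  second moment, bounded by \<open>\<sigma>\<close>.\<close>

lemma sum_trace_exp_add_rank_one_le:
  fixes q :: "'m::finite \<Rightarrow> 'a::euclidean_space" and s \<kappa> \<sigma> :: real
  assumes H: "selfadjoint H"
    and frame: "\<And>x. (\<Sum>j\<in>UNIV. (q j \<bullet> x)\<^sup>2) = (norm x)\<^sup>2"
    and var: "\<And>x. (\<Sum>j\<in>UNIV. (norm (q j))\<^sup>2 * (q j \<bullet> x)\<^sup>2) \<le> \<sigma> * (norm x)\<^sup>2"
    and \<kappa>: "0 \<le> \<kappa>" "\<And>j. exp (s * (norm (q j))\<^sup>2) \<le> 1 + s * (norm (q j))\<^sup>2 + \<kappa> * (s * (norm (q j))\<^sup>2)\<^sup>2"
  shows "(\<Sum>j\<in>UNIV. trace_exp (\<lambda>x. H x + (s * (q j \<bullet> x)) *\<^sub>R q j))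
    \<le> real CARD('m) * exp ((s + \<kappa> * s\<^sup>2 * \<sigma>) / real CARD('m)) * trace_exp H"
proof -
  define U where "U = (SOME B. eigenbasis H B)"
  have U: "eigenbasis H U"
    using selfadjoint_eigenbasis_exists[OF H] unfolding U_def by (metis someI)
  have U1: "norm u = 1" if "u \<in> U" for u using U that by (auto simp: eigenbasis_def)
  define \<psi> where "\<psi> j = (exp (s * (norm (q j))\<^sup>2) - 1) / (norm (q j))\<^sup>2" for j
  define m where "m = real CARD('m)"
  have m: "0 < m" by (simp add: m_def)
  have tr: "trace_exp (\<lambda>x. H x + (s * (q j \<bullet> x)) *\<^sub>R q j) \<le> trace_exp H + \<psi> j * quad_exp_basis H U (q j)" for j
    unfolding trace_exp_def \<psi>_def U_def[symmetric]
    by (intro trace_exp_basis_add_rank_one_le H U someI_ex[of "eigenbasis _"])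
       (metis selfadjoint_eigenbasis_exists[OF selfadjoint_add_rank_one[OF H]])
  \<comment> \<open>The factor \<open>(q j \<bullet> u)\<^sup>2\<close> takes care of
    \<open>q j = 0\<close>, where \<open>\<psi> j\<close> is \<open>0\<close> and
    \<open>\<psi> j \<le> s\<close> would fail for negative \<open>s\<close>.\<close>
  have \<psi>: "\<psi> j * (q j \<bullet> u)\<^sup>2 \<le> s * (q j \<bullet> u)\<^sup>2 + \<kappa> * s\<^sup>2 * ((norm (q j))\<^sup>2 * (q j \<bullet> u)\<^sup>2)" for j u
  proof (cases "q j = 0")
    case False
    then have "\<psi> j \<le> (s * (norm (q j))\<^sup>2 + \<kappa> * (s * (norm (q j))\<^sup>2)\<^sup>2) / (norm (q j))\<^sup>2"
      unfolding \<psi>_def using \<kappa>(2)[of j] by (intro divide_right_mono) auto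
    also have "\<dots> = s + \<kappa> * s\<^sup>2 * (norm (q j))\<^sup>2"
      using False by (simp add: field_simps power2_eq_square)
    finally have "\<psi> j * (q j \<bullet> u)\<^sup>2 \<le> (s + \<kappa> * s\<^sup>2 * (norm (q j))\<^sup>2) * (q j \<bullet> u)\<^sup>2"
      by (intro mult_right_mono) auto
    then show ?thesis by (simp add: algebra_simps)
  qed simp
  have "(\<Sum>j\<in>UNIV. trace_exp (\<lambda>x. H x + (s * (q j \<bullet> x)) *\<^sub>R q j))
      \<le> m * trace_exp H + (\<Sum>j\<in>UNIV. \<psi> j * quad_exp_basis H U (q j))"
    using sum_mono[of UNIV, OF tr] by (simp add: sum.distrib m_def)
  also have "(\<Sum>j\<in>UNIV. \<psi> j * quad_exp_basis H U (q j))
      = (\<Sum>u\<in>U. exp (u \<bullet> H u) * (\<Sum>j\<in>UNIV. \<psi> j * (q j \<bullet> u)\<^sup>2))"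
    unfolding quad_exp_basis_def sum_distrib_left by (subst sum.swap) (simp add: mult_ac)
  also have "\<dots> \<le> (\<Sum>u\<in>U. exp (u \<bullet> H u) * (s + \<kappa> * s\<^sup>2 * \<sigma>))"
  proof (intro sum_mono mult_left_mono)
    fix u assume u: "u \<in> U"
    have "(\<Sum>j\<in>UNIV. \<psi> j * (q j \<bullet> u)\<^sup>2)
        \<le> s * (\<Sum>j\<in>UNIV. (q j \<bullet> u)\<^sup>2) + \<kappa> * s\<^sup>2 * (\<Sum>j\<in>UNIV. (norm (q j))\<^sup>2 * (q j \<bullet> u)\<^sup>2)"
      using sum_mono[of UNIV, OF \<psi>] by (simp add: sum.distrib sum_distrib_left)
    also have "\<dots> \<le> s + \<kappa> * s\<^sup>2 * \<sigma>"
      using var[of u] \<kappa>(1) by (simp add: frame U1[OF u] mult_left_mono)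
    finally show "(\<Sum>j\<in>UNIV. \<psi> j * (q j \<bullet> u)\<^sup>2) \<le> s + \<kappa> * s\<^sup>2 * \<sigma>" .
  qed auto
  also have "\<dots> = (s + \<kappa> * s\<^sup>2 * \<sigma>) * trace_exp H"
    unfolding trace_exp_def trace_exp_basis_def U_def[symmetric] sum_distrib_right[symmetric]
    by (rule mult.commute)
  also have "m * trace_exp H + \<dots> = m * (1 + (s + \<kappa> * s\<^sup>2 * \<sigma>) / m) * trace_exp H"
    using m by (simp add: field_simps)
  \<comment> \<open>The exponential form lets the factors of successive draws merge into one
    exponent.\<close>
  also have "\<dots> \<le> m * exp ((s + \<kappa> * s\<^sup>2 * \<sigma>) / m) * trace_exp H"
    using m by (intro mult_right_mono mult_left_mono trace_exp_nonneg exp_ge_add_one_self) auto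
  finally show ?thesis by (simp add: m_def)
qed


lemma sum_PiE_insert:
  assumes "t \<notin> T"
  shows "(\<Sum>\<kappa>\<in>PiE (insert t T) A. F \<kappa>) = (\<Sum>\<kappa>\<in>PiE T A. \<Sum>j\<in>A t. F (\<kappa>(t := j)))"
proof -
  have "(\<Sum>\<kappa>\<in>PiE (insert t T) A. F \<kappa>) = (\<Sum>p\<in>A t \<times> PiE T A. F ((snd p)(t := fst p)))"
    unfolding PiE_insert_eq
    by (subst sum.reindex[OF inj_combinator[OF assms]]) (simp add: case_prod_unfold)
  also have "\<dots> = (\<Sum>j\<in>A t. \<Sum>\<kappa>\<in>PiE T A. F (\<kappa>(t := j)))"
    by (simp add: sum.cartesian_product case_prod_unfold)
  finally show ?thesis by (subst (asm) sum.swap)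
qed

lemma selfadjoint_frame_operator:
  "selfadjoint (\<lambda>x. \<Sum>t\<in>T. (s * (p t \<bullet> x)) *\<^sub>R p t)"
  unfolding selfadjoint_def
  by (auto intro!: linear_compose_sum linearI
      simp: inner_simps inner_sum_left inner_sum_right inner_commute algebra_simps)

text \<open>Induction on the set of draws: with the earlier draws fixed, their operator is the
  \<open>H\<close> of the next one, which costs one factor. The sum is the expectation times the
  number of index functions.\<close>

lemma sum_trace_exp_sample_le:
  fixes q :: "'m::finite \<Rightarrow> 'a::euclidean_space" and s \<kappa> \<sigma> :: real and T :: "'c set"
  assumes frame: "\<And>x. (\<Sum>j\<in>UNIV. (q j \<bullet> x)\<^sup>2) = (norm x)\<^sup>2"
    and var: "\<And>x. (\<Sum>j\<in>UNIV. (norm (q j))\<^sup>2 * (q j \<bullet> x)\<^sup>2) \<le> \<sigma> * (norm x)\<^sup>2"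
    and \<kappa>: "0 \<le> \<kappa>" "\<And>j. exp (s * (norm (q j))\<^sup>2) \<le> 1 + s * (norm (q j))\<^sup>2 + \<kappa> * (s * (norm (q j))\<^sup>2)\<^sup>2"
    and "finite T"
  shows "(\<Sum>k\<in>PiE T (\<lambda>_. UNIV). trace_exp (\<lambda>x. \<Sum>t\<in>T. (s * (q (k t) \<bullet> x)) *\<^sub>R q (k t)))
    \<le> real DIM('a) * (real CARD('m) * exp ((s + \<kappa> * s\<^sup>2 * \<sigma>) / real CARD('m))) ^ card T"
  using \<open>finite T\<close>
proof (induction T rule: finite_induct)
  case empty
  \<comment> \<open>For the zero operator every term is \<open>exp 0\<close>, so the trace is the
    size of an eigenbasis.\<close>
  have "selfadjoint (\<lambda>x. 0 :: 'a)" by (auto simp: selfadjoint_def intro: linearI)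
  then have "eigenbasis (\<lambda>x. 0 :: 'a) (SOME B. eigenbasis (\<lambda>x. 0) B)"
    using selfadjoint_eigenbasis_exists by (metis someI)
  from eigenbasis_card[OF this] show ?case by (simp add: trace_exp_def trace_exp_basis_def)
next
  case (insert t T)
  define C where "C = real CARD('m) * exp ((s + \<kappa> * s\<^sup>2 * \<sigma>) / real CARD('m))"
  define G where "G T k = (\<lambda>x. \<Sum>t\<in>T. (s * (q (k t) \<bullet> x)) *\<^sub>R q (k t))" for k and T :: "'c set"
  have ins: "G (insert t T) (k(t := j)) = (\<lambda>x. G T k x + (s * (q j \<bullet> x)) *\<^sub>R q j)" for k j
  proof
    fix x
    have "(\<Sum>i\<in>T. (s * (q ((k(t := j)) i) \<bullet> x)) *\<^sub>R q ((k(t := j)) i)) = G T k x"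
      unfolding G_def using insert.hyps(2) by (intro sum.cong) auto
    then show "G (insert t T) (k(t := j)) x = G T k x + (s * (q j \<bullet> x)) *\<^sub>R q j"
      using insert.hyps by (simp add: G_def add.commute)
  qed
  have "(\<Sum>k\<in>PiE (insert t T) (\<lambda>_. UNIV). trace_exp (G (insert t T) k))
      = (\<Sum>k\<in>PiE T (\<lambda>_. UNIV). \<Sum>j\<in>UNIV. trace_exp (\<lambda>x. G T k x + (s * (q j \<bullet> x)) *\<^sub>R q j))"
    by (simp only: sum_PiE_insert[OF insert.hyps(2)] ins)
  also have "\<dots> \<le> (\<Sum>k\<in>PiE T (\<lambda>_. UNIV). C * trace_exp (G T k))"
    unfolding C_def
    by (intro sum_mono sum_trace_exp_add_rank_one_le frame var \<kappa>) (simp add: G_def selfadjoint_frame_operator)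
  also have "\<dots> \<le> C * (real DIM('a) * C ^ card T)"
    using insert.IH unfolding sum_distrib_left[symmetric] C_def[symmetric] G_def
    by (intro mult_left_mono) (auto simp: C_def)
  also have "\<dots> = real DIM('a) * C ^ card (insert t T)"
    using insert.hyps by simp
  finally show ?case by (simp only: C_def G_def)
qed

section \<open>Matrix Bernstein bound for the number of bad samples\<close>

text \<open>Markov's inequality in counting form: each sample in the set adds at least
  \<open>exp a\<close> to the total of the trace exponentials. Positive \<open>s\<close> gives the
  upper tail of the spectrum, negative \<open>s\<close> the lower one.\<close>

lemma card_sample_tail_le:
  fixes q :: "'m::finite \<Rightarrow> 'a::euclidean_space" and s \<kappa> \<sigma> a :: real
  assumes frame: "\<And>x. (\<Sum>j\<in>UNIV. (q j \<bullet> x)\<^sup>2) = (norm x)\<^sup>2"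
    and var: "\<And>x. (\<Sum>j\<in>UNIV. (norm (q j))\<^sup>2 * (q j \<bullet> x)\<^sup>2) \<le> \<sigma> * (norm x)\<^sup>2"
    and \<kappa>: "0 \<le> \<kappa>" "\<And>j. exp (s * (norm (q j))\<^sup>2) \<le> 1 + s * (norm (q j))\<^sup>2 + \<kappa> * (s * (norm (q j))\<^sup>2)\<^sup>2"
  shows "real (card {k :: 'c::finite \<Rightarrow> 'm. \<exists>x\<noteq>0. a * (norm x)\<^sup>2 \<le> s * (\<Sum>t\<in>UNIV. (q (k t) \<bullet> x)\<^sup>2)})
    \<le> real DIM('a) * exp (real CARD('c) * (s + \<kappa> * s\<^sup>2 * \<sigma>) / real CARD('m) - a) * real CARD('m) ^ CARD('c)"
    (is "real (card ?E) \<le> _")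
proof -
  define G where "G k = (\<lambda>x. \<Sum>t\<in>UNIV. (s * (q (k t) \<bullet> x)) *\<^sub>R q (k t))" for k :: "'c \<Rightarrow> 'm"
  have "exp a \<le> trace_exp (G k)" if "k \<in> ?E" for k
  proof -
    from that obtain x where x: "x \<noteq> 0" "a * (norm x)\<^sup>2 \<le> s * (\<Sum>t\<in>UNIV. (q (k t) \<bullet> x)\<^sup>2)" by blast
    have "x \<bullet> G k x = s * (\<Sum>t\<in>UNIV. (q (k t) \<bullet> x)\<^sup>2)"
      by (simp add: G_def inner_sum_right sum_distrib_left power2_eq_square inner_commute mult_ac)
    with x show ?thesis
      by (intro exp_le_trace_exp[of _ x]) (auto simp: G_def selfadjoint_frame_operator)
  qed
  then have "real (card ?E) * exp a \<le> (\<Sum>k\<in>?E. trace_exp (G k))"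
    using sum_mono[of ?E "\<lambda>_. exp a"] by simp
  also have "\<dots> \<le> (\<Sum>k\<in>UNIV. trace_exp (G k))"
    by (intro sum_mono2) (auto simp: trace_exp_nonneg)
  also have "\<dots> \<le> real DIM('a) * (real CARD('m) * exp ((s + \<kappa> * s\<^sup>2 * \<sigma>) / real CARD('m))) ^ CARD('c)"
    using sum_trace_exp_sample_le[of q \<sigma> \<kappa> s "UNIV :: 'c set", OF frame var \<kappa>]
    by (simp add: G_def PiE_UNIV_domain)
  also have "\<dots> = real DIM('a) * exp (real CARD('c) * (s + \<kappa> * s\<^sup>2 * \<sigma>) / real CARD('m)) * real CARD('m) ^ CARD('c)"
    by (simp add: power_mult_distrib flip: exp_of_nat_mult)
  finally have "real (card ?E) * exp a / exp a \<le> \<dots> / exp a"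
    by (intro divide_right_mono) auto
  then show ?thesis by (simp add: exp_diff)
qed

lemma card_sample_bernstein:
  fixes q :: "'m::finite \<Rightarrow> 'a::euclidean_space" and \<mu> \<sigma> \<epsilon> :: real
  assumes frame: "\<And>x. (\<Sum>j\<in>UNIV. (q j \<bullet> x)\<^sup>2) = (norm x)\<^sup>2"
    and var: "\<And>x. (\<Sum>j\<in>UNIV. (norm (q j))\<^sup>2 * (q j \<bullet> x)\<^sup>2) \<le> \<sigma> * (norm x)\<^sup>2"
    and \<mu>: "\<And>j. (norm (q j))\<^sup>2 \<le> \<mu>" and \<epsilon>: "0 < \<epsilon>"
  defines "c \<equiv> real CARD('c)" and "m \<equiv> real CARD('m)"
  shows "real (card {k :: 'c::finite \<Rightarrow> 'm. \<exists>x. \<bar>m / c * (\<Sum>t\<in>UNIV. (q (k t) \<bullet> x)\<^sup>2) - (norm x)\<^sup>2\<bar> > \<epsilon> * (norm x)\<^sup>2})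
    \<le> 2 * real DIM('a) * exp (- (3 / 2) * ((c * \<epsilon>\<^sup>2) / (m * (3 * \<sigma> + \<epsilon> * \<mu>)))) * m ^ CARD('c)"
    (is "real (card ?E) \<le> _")
proof -
  have c: "0 < c" and m: "0 < m" by (simp_all add: c_def m_def)
  have \<mu>0: "0 \<le> \<mu>" using \<mu> by (meson order_trans zero_le_power2)
  \<comment> \<open>Otherwise \<open>var\<close> forces every \<open>q i\<close> to vanish, against
    \<open>frame\<close>.\<close>
  have \<sigma>: "0 < \<sigma>"
  proof (rule ccontr)
    assume "\<not> 0 < \<sigma>"
    then have le: "(\<Sum>j\<in>UNIV. (norm (q j))\<^sup>2 * (q j \<bullet> x)\<^sup>2) \<le> 0" for x
      using var[of x] by (meson mult_nonpos_nonneg not_less order_trans zero_le_power2)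
    have "q i = 0" for i
    proof -
      have "(norm (q i))\<^sup>2 * (q i \<bullet> q i)\<^sup>2 \<le> (\<Sum>j\<in>UNIV. (norm (q j))\<^sup>2 * (q j \<bullet> q i)\<^sup>2)"
        by (rule member_le_sum) auto
      with le[of "q i"] have "(norm (q i))\<^sup>2 * (q i \<bullet> q i)\<^sup>2 \<le> 0" by linarith
      then show ?thesis by (simp add: mult_le_0_iff)
    qed
    then have "norm x = 0" for x :: 'a using frame[of x] by simp
    moreover obtain b :: 'a where "b \<in> Basis" using nonempty_Basis by blast
    ultimately show False by (metis norm_Basis zero_neq_one)
  qed
  \<comment> \<open>Bernstein's parameters for rank-one summands scaled by \<open>m / c\<close>:
    \<open>v\<close> bounds the sum of their expected squares, \<open>R\<close> the norm of each.
    The exponent parameter is \<open>\<theta>\<close>, and \<open>s\<close> absorbs the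
    scaling.\<close>
  define v where "v = m * \<sigma> / c"
  define R where "R = m * \<mu> / c"
  define D where "D = v + R * \<epsilon> / 3"
  define \<theta> where "\<theta> = \<epsilon> / D"
  define s where "s = \<theta> * m / c"
  have v: "0 < v" using c m \<sigma> by (simp add: v_def)
  have R: "0 \<le> R" using c m \<mu>0 by (simp add: R_def)
  have D: "0 < D" using v R \<epsilon> by (simp add: D_def add_pos_nonneg)
  have \<theta>: "0 < \<theta>" using D \<epsilon> by (simp add: \<theta>_def)
  have s: "0 < s" using \<theta> c m by (simp add: s_def)
  \<comment> \<open>This choice of \<open>\<theta>\<close> yields both
    \<open>\<theta> * R < 3\<close> and a closed form for \<open>\<kappa>\<close>.\<close>
  have 1: "1 - \<theta> * R / 3 = v / D" using D by (simp add: \<theta>_def D_def field_simps)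
  moreover have "0 < v / D" using v D by simp
  ultimately have \<theta>R: "\<theta> * R < 3" by linarith
  define \<kappa> where "\<kappa> = 1 / (2 * (1 - \<theta> * R / 3))"
  have \<kappa>D: "\<kappa> = D / (2 * v)" unfolding \<kappa>_def 1 by simp
  have \<kappa>0: "0 \<le> \<kappa>" using v D by (simp add: \<kappa>D)
  \<comment> \<open>The scalar inequality asks only for an upper bound on its argument, so one
    \<open>\<kappa>\<close> serves \<open>s\<close> and \<open>- s\<close>.\<close>
  have \<kappa>: "exp (r * (norm (q j))\<^sup>2) \<le> 1 + r * (norm (q j))\<^sup>2 + \<kappa> * (r * (norm (q j))\<^sup>2)\<^sup>2"
    if "\<bar>r\<bar> \<le> s" for r j
  proof -
    have "r * (norm (q j))\<^sup>2 \<le> s * \<mu>"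
      using that \<mu>[of j] s by (intro mult_mono) auto
    also have "\<dots> = \<theta> * R" by (simp add: s_def R_def)
    finally show ?thesis
      using exp_le_quadratic[of "r * (norm (q j))\<^sup>2" "\<theta> * R"] \<theta> R \<theta>R by (simp add: \<kappa>_def)
  qed
  \<comment> \<open>In both tails \<open>c * s / m = \<theta>\<close> cancels the linear part of the
    threshold \<open>\<theta> * (1 \<plusminus> \<epsilon>)\<close>. What remains is
    \<open>\<epsilon>\<^sup>2 / (2 * D) - \<epsilon>\<^sup>2 / D\<close>.\<close>
  have expo: "c * (\<kappa> * s\<^sup>2 * \<sigma>) / m - \<theta> * \<epsilon> = - (3 / 2) * ((c * \<epsilon>\<^sup>2) / (m * (3 * \<sigma> + \<epsilon> * \<mu>)))"
  proof -
    have "c * (\<kappa> * s\<^sup>2 * \<sigma>) / m = \<kappa> * \<theta>\<^sup>2 * v"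
      using c m by (simp add: s_def v_def power2_eq_square)
    also have "\<dots> = \<epsilon>\<^sup>2 / (2 * D)"
      using v D by (simp add: \<kappa>D \<theta>_def power2_eq_square)
    finally have "c * (\<kappa> * s\<^sup>2 * \<sigma>) / m - \<theta> * \<epsilon> = - \<epsilon>\<^sup>2 / (2 * D)"
      using D by (simp add: \<theta>_def field_simps power2_eq_square)
    moreover have "D = m * (3 * \<sigma> + \<epsilon> * \<mu>) / (3 * c)"
      using c by (simp add: D_def v_def R_def field_simps)
    ultimately show ?thesis using c by simp
  qed
  define P where "P = exp (- (3 / 2) * ((c * \<epsilon>\<^sup>2) / (m * (3 * \<sigma> + \<epsilon> * \<mu>))))"
  define Eu where "Eu = {k :: 'c \<Rightarrow> 'm. \<exists>x\<noteq>0. \<theta> * (1 + \<epsilon>) * (norm x)\<^sup>2 \<le> s * (\<Sum>t\<in>UNIV. (q (k t) \<bullet> x)\<^sup>2)}"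
  define El where "El = {k :: 'c \<Rightarrow> 'm. \<exists>x\<noteq>0. - \<theta> * (1 - \<epsilon>) * (norm x)\<^sup>2 \<le> (- s) * (\<Sum>t\<in>UNIV. (q (k t) \<bullet> x)\<^sup>2)}"
  have cs: "c * s / m = \<theta>" using c m by (simp add: s_def)
  have "real (card Eu) \<le> real DIM('a) * P * m ^ CARD('c)"
  proof -
    have "c * (s + \<kappa> * s\<^sup>2 * \<sigma>) / m - \<theta> * (1 + \<epsilon>) = c * (\<kappa> * s\<^sup>2 * \<sigma>) / m - \<theta> * \<epsilon>"
      using cs by (simp add: algebra_simps add_divide_distrib)
    then show ?thesis
      using card_sample_tail_le[OF frame var \<kappa>0 \<kappa>[of s], of "\<theta> * (1 + \<epsilon>)", where 'c = 'c] s
      unfolding P_def expo[symmetric] c_def[symmetric] m_def[symmetric] Eu_def by simp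
  qed
  moreover have "real (card El) \<le> real DIM('a) * P * m ^ CARD('c)"
  proof -
    have "c * (- s + \<kappa> * s\<^sup>2 * \<sigma>) / m - (- \<theta> * (1 - \<epsilon>)) = c * (\<kappa> * s\<^sup>2 * \<sigma>) / m - \<theta> * \<epsilon>"
      using cs by (simp add: algebra_simps add_divide_distrib diff_divide_distrib)
    then show ?thesis
      using card_sample_tail_le[OF frame var \<kappa>0 \<kappa>[of "- s"], of "- \<theta> * (1 - \<epsilon>)", where 'c = 'c] s
      unfolding P_def expo[symmetric] c_def[symmetric] m_def[symmetric] El_def by simp
  qed
  moreover have "?E \<subseteq> Eu \<union> El"
  proof
    fix k assume "k \<in> ?E"
    then obtain x where x: "\<epsilon> * (norm x)\<^sup>2 < \<bar>m / c * (\<Sum>t\<in>UNIV. (q (k t) \<bullet> x)\<^sup>2) - (norm x)\<^sup>2\<bar>" by blast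
    then have x0: "x \<noteq> 0" by auto
    define g where "g = (\<Sum>t\<in>UNIV. (q (k t) \<bullet> x)\<^sup>2)"
    have sg: "s * g = \<theta> * (m / c * g)" by (simp add: s_def)
    from x consider "(1 + \<epsilon>) * (norm x)\<^sup>2 \<le> m / c * g" | "m / c * g \<le> (1 - \<epsilon>) * (norm x)\<^sup>2"
      unfolding g_def[symmetric] by (fastforce simp: abs_if algebra_simps split: if_splits)
    then show "k \<in> Eu \<union> El"
    proof cases
      case 1
      then have "\<theta> * ((1 + \<epsilon>) * (norm x)\<^sup>2) \<le> s * g"
        unfolding sg using \<theta> by (intro mult_left_mono) auto
      then show ?thesis using x0 by (auto simp: Eu_def g_def mult.assoc)
    next
      case 2
      then have "s * g \<le> \<theta> * ((1 - \<epsilon>) * (norm x)\<^sup>2)"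
        unfolding sg using \<theta> by (intro mult_left_mono) auto
      then have "- \<theta> * (1 - \<epsilon>) * (norm x)\<^sup>2 \<le> (- s) * g" by (simp add: mult.assoc)
      then show ?thesis using x0 unfolding El_def g_def by blast
    qed
  qed
  then have "card ?E \<le> card Eu + card El"
    by (meson card_Un_le card_mono finite order_trans)
  ultimately show ?thesis unfolding P_def[symmetric] by linarith
qed

section \<open>Quadratic forms, operator norms and condition numbers\<close>

lemma inner_transpose_mult: "x \<bullet> (transpose A *v y) = (A *v x) \<bullet> y" for A :: "real^'n^'m"
proof -
  have "x \<bullet> (transpose A *v y) = (y v* A) \<bullet> x" by (simp add: inner_commute)
  also have "\<dots> = (A *v x) \<bullet> y" by (simp only: dot_lmul_matrix inner_commute[of y])
  finally show ?thesis .
qed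

text \<open>\<open>A ** X\<close> is symmetric and idempotent, hence an orthogonal projection, which
  does not increase norms. The lower bound at \<open>X *v y\<close> therefore bounds the
  pseudoinverse by \<open>1 / l\<close>.\<close>

lemma condition_number_le:
  fixes A :: "real^'n^'p"
  assumes lu: "0 < l" "0 \<le> u"
    and lower: "\<And>x. l * norm x \<le> norm (A *v x)" and upper: "\<And>x. norm (A *v x) \<le> u * norm x"
  shows "rank A = CARD('n)" and "condition_number A \<le> u / l"
proof -
  have "x = y" if "A *v x = A *v y" for x y
  proof -
    have "l * norm (x - y) \<le> 0"
      using lower[of "x - y"] that by (simp add: matrix_vector_mult_diff_distrib)
    then show ?thesis using lu(1) by (simp add: mult_le_0_iff)
  qed
  then show rank: "rank A = CARD('n)"
    by (simp add: full_rank_injective inj_def)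
  define X where "X = moore_penrose A"
  have X: "is_moore_penrose A X"
    unfolding X_def by (metis is_moore_penrose_full_column_rank moore_penrose_eqI rank)
  have "norm (X *v y) \<le> (1 / l) * norm y" for y
  proof -
    define z where "z = A *v (X *v y)"
    have P: "z = (A ** X) *v y" by (simp add: z_def matrix_vector_mul_assoc)
    have "z \<bullet> z = ((A ** X) *v y) \<bullet> ((A ** X) *v y)" by (simp add: P)
    also have "\<dots> = y \<bullet> (transpose (A ** X) *v ((A ** X) *v y))"
      by (simp only: inner_transpose_mult)
    also have "\<dots> = y \<bullet> (((A ** X) ** (A ** X)) *v y)"
      using X by (simp add: is_moore_penrose_def matrix_vector_mul_assoc)
    also have "(A ** X) ** (A ** X) = A ** X"
      using X by (simp add: is_moore_penrose_def matrix_mul_assoc)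
    also have "y \<bullet> ((A ** X) *v y) \<le> norm y * norm z"
      unfolding P by (rule norm_cauchy_schwarz)
    finally have "norm z * norm z \<le> norm y * norm z"
      by (simp add: power2_norm_eq_inner[symmetric] power2_eq_square)
    then have "norm z \<le> norm y"
      by (metis mult_right_le_imp_le norm_ge_zero norm_le_zero_iff order_le_less norm_zero)
    then have "l * norm (X *v y) \<le> norm y"
      using lower[of "X *v y"] by (simp add: z_def)
    then show ?thesis using lu(1) by (simp add: field_simps)
  qed
  then have "matrix_norm2 X \<le> 1 / l"
    unfolding matrix_norm2_def by (rule onorm_le)
  moreover have "matrix_norm2 A \<le> u"
    unfolding matrix_norm2_def using upper by (rule onorm_le)
  moreover have "0 \<le> matrix_norm2 X"
    unfolding matrix_norm2_def by (rule onorm_pos_le) (rule matrix_vector_mul_bounded_linear)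
  ultimately have "matrix_norm2 A * matrix_norm2 X \<le> u * (1 / l)"
    using lu(2) by (intro mult_mono)
  then show "condition_number A \<le> u / l"
    by (simp add: condition_number_def X_def)
qed

lemma leverage_score_eq: "leverage_score Q j = (norm (Q $ j))\<^sup>2"
proof -
  have "axis j 1 v* Q = Q $ j"
    by (simp add: vec_eq_iff vector_matrix_mult_def axis_def if_distrib[of "\<lambda>z. z * _"] cong: if_cong)
  then show ?thesis by (simp add: leverage_score_def)
qed

lemma norm_matrix_vector_mult_sq: "(norm (A *v x))\<^sup>2 = (\<Sum>j\<in>UNIV. (A $ j \<bullet> x)\<^sup>2)"
  for A :: "real^'n^'m"
  by (simp add: norm_vec_def L2_set_def sum_nonneg matrix_vector_mul_component)

text \<open>The left side is the quadratic form at \<open>x\<close> of the matrix on the right. With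
  leverage scores as weights it is the second-moment bound.\<close>

lemma weighted_frame_le:
  fixes Q :: "real^'n^'m"
  shows "(\<Sum>j\<in>UNIV. d j * (Q $ j \<bullet> x)\<^sup>2)
    \<le> matrix_norm2 (transpose Q ** diag_matrix d ** Q) * (norm x)\<^sup>2"
proof -
  let ?N = "transpose Q ** diag_matrix d ** Q"
  have "(diag_matrix d *v y) $ j = d j * y $ j" for y :: "real^'m" and j
    by (simp add: matrix_vector_mult_def diag_matrix_def if_distrib[of "\<lambda>z. z * _"] cong: if_cong)
  then have "(\<Sum>j\<in>UNIV. d j * (Q $ j \<bullet> x)\<^sup>2) = (Q *v x) \<bullet> (diag_matrix d *v (Q *v x))"
    by (simp add: inner_vec_def[of "Q *v x"] matrix_vector_mul_component power2_eq_square mult_ac)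
  also have "\<dots> = x \<bullet> (?N *v x)"
    by (simp only: matrix_vector_mul_assoc[symmetric] inner_transpose_mult)
  also have "\<dots> \<le> norm x * norm (?N *v x)" by (rule norm_cauchy_schwarz)
  also have "\<dots> \<le> norm x * (matrix_norm2 ?N * norm x)"
    unfolding matrix_norm2_def by (intro mult_left_mono onorm matrix_vector_mul_bounded_linear) auto
  finally show ?thesis by (simp add: power2_eq_square mult_ac)
qed

lemma norm_sampling_mult_sq:
  fixes k :: "'c::finite \<Rightarrow> 'm::finite" and Q :: "real^'n^'m"
  shows "(norm ((sampling_matrix k ** Q) *v x))\<^sup>2
    = real CARD('m) / real CARD('c) * (\<Sum>t\<in>UNIV. (Q $ k t \<bullet> x)\<^sup>2)"
proof -
  have "(sampling_matrix k :: real^'m^'c) $ t \<bullet> y = sqrt (real CARD('m) / real CARD('c)) * y $ k t" for t y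
    by (simp add: sampling_matrix_def inner_axis')
  then show ?thesis
    by (simp add: matrix_vector_mul_assoc[symmetric] norm_matrix_vector_mult_sq[of "sampling_matrix k"]
        matrix_vector_mul_component power_mult_distrib sum_distrib_left del: matrix_vector_mul_assoc)
qed

section \<open>Probabilities of samples as counts\<close>

text \<open>Independence and uniformity give every index function the same probability, and the
  event is the disjoint union of the fibres \<open>E f\<close>.\<close>

lemma prob_uniform_with_replacement:
  fixes k :: "'c::finite \<Rightarrow> 'a \<Rightarrow> 'm::finite"
  assumes M: "prob_space M" and k: "uniform_with_replacement M k"
  shows "measure M {\<omega> \<in> space M. P (\<lambda>t. k t \<omega>)} = real (card {f. P f}) / real CARD('m) ^ CARD('c)"
proof -
  interpret prob_space M by (rule M)
  have iv: "indep_vars (\<lambda>_. count_space UNIV) k UNIV"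
    and distr: "\<And>t. distr M (count_space UNIV) (k t) = uniform_count_measure UNIV"
    using k by (auto simp: uniform_with_replacement_def)
  have rv: "k t \<in> measurable M (count_space UNIV)" for t
    using iv by (simp add: indep_vars_def)
  have one: "prob (k t -` {j} \<inter> space M) = 1 / real CARD('m)" for t j
  proof -
    have "prob (k t -` {j} \<inter> space M) = measure (distr M (count_space UNIV) (k t)) {j}"
      using rv by (simp add: measure_distr)
    also have "\<dots> = 1 / real CARD('m)"
      unfolding distr by (simp add: measure_uniform_count_measure)
    finally show ?thesis .
  qed
  define E where "E f = (\<Inter>t\<in>UNIV. k t -` {f t} \<inter> space M)" for f
  have E: "prob (E f) = 1 / real CARD('m) ^ CARD('c)" for f
    unfolding E_def using indep_varsD[OF iv, of UNIV "\<lambda>t. {f t}"] by (simp add: one power_divide)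
  have "{\<omega> \<in> space M. P (\<lambda>t. k t \<omega>)} = (\<Union>f\<in>{f. P f}. E f)"
    by (auto simp: E_def)
  moreover have "prob (\<Union>f\<in>{f. P f}. E f) = (\<Sum>f\<in>{f. P f}. prob (E f))"
  proof (rule finite_measure_finite_Union)
    show "E ` {f. P f} \<subseteq> sets M"
      unfolding E_def by (intro image_subsetI sets.finite_INT measurable_sets[OF rv]) auto
    show "disjoint_family_on E {f. P f}"
      by (auto simp: disjoint_family_on_def E_def fun_eq_iff)
  qed auto
  ultimately show ?thesis by (simp add: E)
qed

section \<open>Conditioning of the sampled matrix\<close>

theorem theorem5p2:
  fixes Q :: "real^'n^'m"
    and L :: "real^'m^'m"
    and M :: "'a measure"
    and k :: "'c::finite \<Rightarrow> 'a \<Rightarrow> 'm"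
    and S :: "'a \<Rightarrow> real^'m^'c"
    and \<mu> \<epsilon> \<delta> :: real
  assumes "transpose Q ** Q = mat 1"
    and "\<mu> = coherence Q"
    and "L = diag_matrix (leverage_score Q)"
    and "CARD('n) \<le> CARD('c)" and "CARD('c) \<le> CARD('m)"
    and "prob_space M"
    and "uniform_with_replacement M k"
    and "\<And>\<omega>. S \<omega> = sampling_matrix (\<lambda>t. k t \<omega>)"
    and "0 < \<epsilon>" and "\<epsilon> < 1"
    and "\<delta> = 2 * real CARD('n) * exp (- (3 / 2) *
           ((real CARD('c) * \<epsilon>\<^sup>2) /
            (real CARD('m) * (3 * matrix_norm2 (transpose Q ** L ** Q) + \<epsilon> * \<mu>))))"
    and "\<delta> < 1"
  shows "measure M {\<omega> \<in> space M. rank (S \<omega> ** Q) = CARD('n) \<and>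
           condition_number (S \<omega> ** Q) \<le> sqrt ((1 + \<epsilon>) / (1 - \<epsilon>))} \<ge> 1 - \<delta>"
proof -
  define N where "N = real CARD('m) ^ CARD('c)"
  have N: "0 < N" by (simp add: N_def)
  define good where "good f \<longleftrightarrow> rank (sampling_matrix f ** Q) = CARD('n) \<and>
    condition_number (sampling_matrix f ** Q) \<le> sqrt ((1 + \<epsilon>) / (1 - \<epsilon>))" for f :: "'c \<Rightarrow> 'm"
  \<comment> \<open>In some direction the Gram matrix of the sampled rows deviates from the identity
    by more than \<open>\<epsilon>\<close>.\<close>
  define bad where "bad f \<longleftrightarrow> (\<exists>x. \<bar>real CARD('m) / real CARD('c) * (\<Sum>t\<in>UNIV. (Q $ f t \<bullet> x)\<^sup>2) - (norm x)\<^sup>2\<bar>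
    > \<epsilon> * (norm x)\<^sup>2)" for f :: "'c \<Rightarrow> 'm"
  have frame: "(\<Sum>j\<in>UNIV. (Q $ j \<bullet> x)\<^sup>2) = (norm x)\<^sup>2" for x
  proof -
    have "(norm (Q *v x))\<^sup>2 = x \<bullet> (transpose Q *v (Q *v x))"
      by (simp only: inner_transpose_mult power2_norm_eq_inner)
    also have "\<dots> = (norm x)\<^sup>2"
      by (simp add: matrix_vector_mul_assoc assms(1) power2_norm_eq_inner)
    finally show ?thesis by (simp only: norm_matrix_vector_mult_sq)
  qed
  have var: "(\<Sum>j\<in>UNIV. (norm (Q $ j))\<^sup>2 * (Q $ j \<bullet> x)\<^sup>2)
      \<le> matrix_norm2 (transpose Q ** L ** Q) * (norm x)\<^sup>2" for x
    using weighted_frame_le[of "leverage_score Q" Q x] by (simp add: assms(3) leverage_score_eq)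
  have coh: "(norm (Q $ j))\<^sup>2 \<le> \<mu>" for j
    by (simp add: assms(2) coherence_def flip: leverage_score_eq)
  have "real (card {f. bad f}) \<le> \<delta> * N"
    using card_sample_bernstein[of "($) Q" _ \<mu> \<epsilon>, OF frame var coh \<open>0 < \<epsilon>\<close>, where 'c = 'c]
    unfolding bad_def N_def assms(11) by simp
  \<comment> \<open>Outside \<open>bad\<close> all squared singular values lie between
    \<open>1 - \<epsilon>\<close> and \<open>1 + \<epsilon>\<close>.\<close>
  moreover have "good f" if "\<not> bad f" for f
  proof -
    let ?A = "sampling_matrix f ** Q"
    have *: "\<bar>(norm (?A *v x))\<^sup>2 - (norm x)\<^sup>2\<bar> \<le> \<epsilon> * (norm x)\<^sup>2" for x
      using that by (simp add: bad_def not_less norm_sampling_mult_sq)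
    have "sqrt (1 - \<epsilon>) * norm x \<le> norm (?A *v x)" for x
    proof (rule power2_le_imp_le)
      show "(sqrt (1 - \<epsilon>) * norm x)\<^sup>2 \<le> (norm (?A *v x))\<^sup>2"
        using *[of x] assms(10) by (simp add: power_mult_distrib abs_le_iff algebra_simps)
    qed simp
    moreover have "norm (?A *v x) \<le> sqrt (1 + \<epsilon>) * norm x" for x
    proof (rule power2_le_imp_le)
      show "(norm (?A *v x))\<^sup>2 \<le> (sqrt (1 + \<epsilon>) * norm x)\<^sup>2"
        using *[of x] assms(9) by (simp add: power_mult_distrib abs_le_iff algebra_simps)
    qed (use assms(9) in simp)
    ultimately show ?thesis
      using condition_number_le[of "sqrt (1 - \<epsilon>)" "sqrt (1 + \<epsilon>)" ?A] assms(9,10)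
      by (simp add: good_def real_sqrt_divide)
  qed
  then have "- {f. bad f} \<subseteq> {f. good f}" by blast
  then have "card (- {f. bad f}) \<le> card {f. good f}" by (intro card_mono) auto
  moreover have "card {f. bad f} + card (- {f. bad f}) = CARD('m) ^ CARD('c)"
    using card_Un_disjoint[of "{f. bad f}" "- {f. bad f}"] by (simp add: card_fun Compl_partition)
  then have "real (card {f. bad f}) + real (card (- {f. bad f})) = N"
    by (simp add: N_def flip: of_nat_add of_nat_power)
  ultimately have "(1 - \<delta>) * N \<le> real (card {f. good f})" by (simp add: left_diff_distrib)
  then have "1 - \<delta> \<le> real (card {f. good f}) / N" using N by (simp add: field_simps)
  also have "\<dots> = measure M {\<omega> \<in> space M. good (\<lambda>t. k t \<omega>)}"
    unfolding N_def by (rule prob_uniform_with_replacement[OF assms(6,7), symmetric])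
  finally show ?thesis by (simp add: good_def assms(8))
qed

end
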